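(* Let $(Q,\cdot,\backslash,/)$ be a middle Bol loop and let $g_2:Q^2\to Q$ be defined by $g_2(x,y)=x/(yx)$ or $g_2(x,y)=(y\backslash x)/x$. Below each identity is required for all $x,y\in Q$. 1. $(Q,\cdot)$ satisfies $(xy)x=x(yx)$ if and only if $g_2(x,y)=g_2(x,xy)\cdot x$. 2. $(Q,\cdot)$ satisfies $x(x(yx))=(x(xy))x$ if and only if $g_2(x,y)=\big(g_2(x,x(xy))\,x\big)\cdot x$. 3. $(Q,\cdot)$ satisfies $x(x(yx))=((xx)y)x$ if and only if $g_2(x,y)=\big(g_2(x,(xx)y)\,x\big)\cdot x$. 4. If $(Q,\cdot)$ satisfies $(xx)y=x(xy)$, then the following are equivalent: (a) $(Q,\cdot)$ satisfies $(x(xy))x=x(x(yx))$. (b) $(Q,\cdot)$ satisfies $((xx)y)x=x(x(yx))$. (c) $(Q,\cdot)$ satisfies $(xx)(yx)=((xx)y)x$.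
   Context: A loop $(Q,\cdot,\backslash,/)$ is a loop $(Q,\cdot)$ with identity $e$, where $x\backslash y$ is the unique $z$ with $x\cdot z=y$ and $x/y$ is the unique $z$ with $z\cdot y=x$. It is a middle Bol loop if $x((yz)\backslash x)=(x/z)(y\backslash x)$ for all $x,y,z$. In a middle Bol loop the two expressions given for $g_2$ agree. *)

theory Defs
  imports "HOL-Algebra.Group"
begin

text \<open>
  A loop is carried by the \<open>monoid\<close> record (carrier, multiplication, identity), whose type does not
  presuppose associativity. The two divisions are determined by the multiplication; outside the
  carrier their values are unspecified.
\<close>

definition ldiv :: "('a, 'b) monoid_scheme \<Rightarrow> 'a \<Rightarrow> 'a \<Rightarrow> 'a" (infixl "\<setminus>\<index>" 70)
  where "x \<setminus>\<^bsub>Q\<^esub> y = (THE z. z \<in> carrier Q \<and> x \<otimes>\<^bsub>Q\<^esub> z = y)"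

definition rdiv :: "('a, 'b) monoid_scheme \<Rightarrow> 'a \<Rightarrow> 'a \<Rightarrow> 'a" (infixl "\<oslash>\<index>" 70)
  where "x \<oslash>\<^bsub>Q\<^esub> y = (THE z. z \<in> carrier Q \<and> z \<otimes>\<^bsub>Q\<^esub> y = x)"

locale loop =
  fixes Q (structure)
  assumes m_closed: "\<lbrakk>x \<in> carrier Q; y \<in> carrier Q\<rbrakk> \<Longrightarrow> x \<otimes> y \<in> carrier Q"
    and one_closed: "\<one> \<in> carrier Q"
    and l_one: "x \<in> carrier Q \<Longrightarrow> \<one> \<otimes> x = x"
    and r_one: "x \<in> carrier Q \<Longrightarrow> x \<otimes> \<one> = x"
    and l_solve: "\<lbrakk>x \<in> carrier Q; y \<in> carrier Q\<rbrakk> \<Longrightarrow> \<exists>!z. z \<in> carrier Q \<and> x \<otimes> z = y"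
    and r_solve: "\<lbrakk>x \<in> carrier Q; y \<in> carrier Q\<rbrakk> \<Longrightarrow> \<exists>!z. z \<in> carrier Q \<and> z \<otimes> y = x"

locale middle_bol_loop = loop +
  assumes middle_bol:
    "\<lbrakk>x \<in> carrier Q; y \<in> carrier Q; z \<in> carrier Q\<rbrakk>
      \<Longrightarrow> x \<otimes> ((y \<otimes> z) \<setminus> x) = (x \<oslash> z) \<otimes> (y \<setminus> x)"

end

theory Submission
  imports Defs
begin

text \<open>
  Fix \<open>x\<close> and consider the permutation \<open>D z = z \<setminus> x\<close> of the loop, with inverse \<open>z \<mapsto> x \<oslash> z\<close>. Two
  specialisations of the middle Bol identity relate it to the translations by \<open>x\<close>:
  putting \<open>z = x\<close> gives \<open>x \<otimes> D (s \<otimes> x) = D s\<close>, so \<open>D\<close> carries the right translation by \<open>x\<close> to the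
  inverse of the left one; putting \<open>y = \<one>\<close> gives \<open>(x \<oslash> z) \<otimes> x = x \<otimes> D z\<close>, that is
  \<open>w \<otimes> x = x \<otimes> D (D w)\<close>.

  These two rules show that both expressions for \<open>g2 x y\<close> are the solution of \<open>g \<otimes> x = D y\<close>, and
  they push \<open>D\<close> through any equation \<open>w \<otimes> x = x \<otimes> (\<dots> (y \<otimes> x))\<close>: after cancelling left factors
  \<open>x\<close> it becomes \<open>D y = D w \<otimes> x\<close> or \<open>D y = (D w \<otimes> x) \<otimes> x\<close>
  (lemmas \<open>mult_eq_mult_iff_ldiv\<close> and \<open>mult_eq_mult_mult_iff_ldiv\<close>). Since \<open>w\<close> is arbitrary there,
  the first three equivalences already hold pointwise in \<open>x\<close> and \<open>y\<close>: take for \<open>w\<close> the element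
  \<open>x \<otimes> y\<close>, \<open>x \<otimes> (x \<otimes> y)\<close> or \<open>(x \<otimes> x) \<otimes> y\<close>. In the fourth part the left alternative law,
  applied to \<open>y\<close> or to \<open>y \<otimes> x\<close>, turns each of the three identities into the others.
\<close>

context loop
begin

lemma l_cancel_iff:
  assumes "x \<in> carrier Q" "y \<in> carrier Q" "z \<in> carrier Q"
  shows "x \<otimes> y = x \<otimes> z \<longleftrightarrow> y = z"
  using l_solve[of x "x \<otimes> z"] assms m_closed by blast

lemma r_cancel_iff:
  assumes "x \<in> carrier Q" "y \<in> carrier Q" "z \<in> carrier Q"
  shows "y \<otimes> x = z \<otimes> x \<longleftrightarrow> y = z"
  using r_solve[of "z \<otimes> x" x] assms m_closed by blast

lemma ldiv_closed: "\<lbrakk>x \<in> carrier Q; y \<in> carrier Q\<rbrakk> \<Longrightarrow> x \<setminus> y \<in> carrier Q"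
  and mult_ldiv: "\<lbrakk>x \<in> carrier Q; y \<in> carrier Q\<rbrakk> \<Longrightarrow> x \<otimes> (x \<setminus> y) = y"
  using theI'[OF l_solve] unfolding ldiv_def by blast+

lemma rdiv_closed: "\<lbrakk>x \<in> carrier Q; y \<in> carrier Q\<rbrakk> \<Longrightarrow> x \<oslash> y \<in> carrier Q"
  and rdiv_mult: "\<lbrakk>x \<in> carrier Q; y \<in> carrier Q\<rbrakk> \<Longrightarrow> (x \<oslash> y) \<otimes> y = x"
  using theI'[OF r_solve] unfolding rdiv_def by blast+

lemma rdiv_eqI:
  assumes "y \<in> carrier Q" "z \<in> carrier Q" "z \<otimes> y = x"
  shows "x \<oslash> y = z"
proof -
  have "x \<in> carrier Q" using assms m_closed by blast
  then show ?thesis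
    using assms rdiv_closed rdiv_mult r_cancel_iff[of y "x \<oslash> y" z] by simp
qed

lemma one_ldiv: "x \<in> carrier Q \<Longrightarrow> \<one> \<setminus> x = x"
  using l_one[of "\<one> \<setminus> x"] mult_ldiv[of \<one> x] ldiv_closed one_closed by simp

lemma rdiv_self: "x \<in> carrier Q \<Longrightarrow> x \<oslash> x = \<one>"
  by (simp add: rdiv_eqI one_closed l_one)

lemma rdiv_ldiv: "\<lbrakk>x \<in> carrier Q; y \<in> carrier Q\<rbrakk> \<Longrightarrow> x \<oslash> (y \<setminus> x) = y"
  by (simp add: rdiv_eqI ldiv_closed mult_ldiv)

lemma ldiv_same_eq_iff:
  assumes "x \<in> carrier Q" "y \<in> carrier Q" "z \<in> carrier Q"
  shows "y \<setminus> x = z \<setminus> x \<longleftrightarrow> y = z"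
  using assms rdiv_ldiv by metis

end

context middle_bol_loop
begin

text \<open>
  The case \<open>z = x\<close> of the middle Bol identity: the factor \<open>x \<oslash> x\<close> disappears.
\<close>

lemma mult_ldiv_mult:
  assumes "x \<in> carrier Q" "s \<in> carrier Q"
  shows "x \<otimes> ((s \<otimes> x) \<setminus> x) = s \<setminus> x"
  using middle_bol[of x s x] assms by (simp add: rdiv_self l_one ldiv_closed)

text \<open>
  The case \<open>y = \<one>\<close> of the middle Bol identity, and the same with \<open>w\<close> written as
  \<open>x \<oslash> (w \<setminus> x)\<close>: a right factor \<open>x\<close> becomes a left factor \<open>x\<close>.
\<close>

lemma rdiv_mult_eq_mult_ldiv:
  assumes "x \<in> carrier Q" "z \<in> carrier Q"
  shows "(x \<oslash> z) \<otimes> x = x \<otimes> (z \<setminus> x)"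
  using middle_bol[of x \<one> z] assms by (simp add: one_closed l_one one_ldiv)

lemma mult_eq_mult_ldiv_ldiv:
  assumes "x \<in> carrier Q" "w \<in> carrier Q"
  shows "w \<otimes> x = x \<otimes> ((w \<setminus> x) \<setminus> x)"
  using rdiv_mult_eq_mult_ldiv[of x "w \<setminus> x"] assms by (simp add: rdiv_ldiv ldiv_closed)

text \<open>
  Both expressions for \<open>g2\<close> are determined by this product, because right multiplication by \<open>x\<close>
  can be cancelled.
\<close>

lemma rdiv_mult_mult_eq_ldiv:
  assumes "x \<in> carrier Q" "y \<in> carrier Q"
  shows "(x \<oslash> (y \<otimes> x)) \<otimes> x = y \<setminus> x"
  using assms by (simp add: rdiv_mult_eq_mult_ldiv mult_ldiv_mult m_closed)

text \<open>
  With \<open>D z = z \<setminus> x\<close>, the left side is \<open>x \<otimes> D (D w) = x \<otimes> (x \<otimes> D (D w \<otimes> x))\<close> and the right side is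
  \<open>x \<otimes> (x \<otimes> D (D y))\<close>, so the equation reduces to one under the injective map \<open>D\<close>.
\<close>

lemma mult_eq_mult_iff_ldiv:
  assumes "x \<in> carrier Q" "y \<in> carrier Q" "w \<in> carrier Q"
  shows "w \<otimes> x = x \<otimes> (y \<otimes> x) \<longleftrightarrow> y \<setminus> x = (w \<setminus> x) \<otimes> x"
proof -
  let ?u = "w \<setminus> x" and ?t = "y \<setminus> x"
  have c: "?u \<in> carrier Q" "?t \<in> carrier Q" using assms ldiv_closed by auto
  have "w \<otimes> x = x \<otimes> (x \<otimes> ((?u \<otimes> x) \<setminus> x))"
    using assms c mult_eq_mult_ldiv_ldiv[of x w] by (simp add: mult_ldiv_mult)
  moreover have "x \<otimes> (y \<otimes> x) = x \<otimes> (x \<otimes> (?t \<setminus> x))"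
    using assms mult_eq_mult_ldiv_ldiv[of x y] by simp
  ultimately have "w \<otimes> x = x \<otimes> (y \<otimes> x) \<longleftrightarrow> (?u \<otimes> x) \<setminus> x = ?t \<setminus> x"
    using assms c by (simp add: l_cancel_iff m_closed ldiv_closed)
  then show ?thesis
    using assms c by (auto simp: ldiv_same_eq_iff m_closed)
qed

text \<open>
  The same reduction with one more left factor \<open>x\<close>, which costs one more passage of a right factor
  \<open>x\<close> through \<open>D\<close>.
\<close>

lemma mult_eq_mult_mult_iff_ldiv:
  assumes "x \<in> carrier Q" "y \<in> carrier Q" "w \<in> carrier Q"
  shows "w \<otimes> x = x \<otimes> (x \<otimes> (y \<otimes> x)) \<longleftrightarrow> y \<setminus> x = ((w \<setminus> x) \<otimes> x) \<otimes> x"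
proof -
  let ?u = "w \<setminus> x" and ?t = "y \<setminus> x"
  have c: "?u \<in> carrier Q" "?t \<in> carrier Q" using assms ldiv_closed by auto
  have "w \<otimes> x = x \<otimes> (x \<otimes> (x \<otimes> (((?u \<otimes> x) \<otimes> x) \<setminus> x)))"
    using assms c mult_eq_mult_ldiv_ldiv[of x w] by (simp add: mult_ldiv_mult m_closed)
  moreover have "x \<otimes> (x \<otimes> (y \<otimes> x)) = x \<otimes> (x \<otimes> (x \<otimes> (?t \<setminus> x)))"
    using assms mult_eq_mult_ldiv_ldiv[of x y] by simp
  ultimately have "w \<otimes> x = x \<otimes> (x \<otimes> (y \<otimes> x)) \<longleftrightarrow> ((?u \<otimes> x) \<otimes> x) \<setminus> x = ?t \<setminus> x"
    using assms c by (simp add: l_cancel_iff m_closed ldiv_closed)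
  then show ?thesis
    using assms c by (auto simp: ldiv_same_eq_iff m_closed)
qed

end

theorem theorem2p7:
  fixes Q :: "('a, 'b) monoid_scheme" (structure)
    and g2 :: "'a \<Rightarrow> 'a \<Rightarrow> 'a"
  assumes Q: "middle_bol_loop Q"
    and g2: "(\<forall>x\<in>carrier Q. \<forall>y\<in>carrier Q. g2 x y = x \<oslash> (y \<otimes> x)) \<or>
             (\<forall>x\<in>carrier Q. \<forall>y\<in>carrier Q. g2 x y = (y \<setminus> x) \<oslash> x)"
  shows
    "((\<forall>x\<in>carrier Q. \<forall>y\<in>carrier Q. (x \<otimes> y) \<otimes> x = x \<otimes> (y \<otimes> x)) \<longleftrightarrow>
      (\<forall>x\<in>carrier Q. \<forall>y\<in>carrier Q. g2 x y = g2 x (x \<otimes> y) \<otimes> x))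
     \<and>
     ((\<forall>x\<in>carrier Q. \<forall>y\<in>carrier Q. x \<otimes> (x \<otimes> (y \<otimes> x)) = (x \<otimes> (x \<otimes> y)) \<otimes> x) \<longleftrightarrow>
      (\<forall>x\<in>carrier Q. \<forall>y\<in>carrier Q. g2 x y = (g2 x (x \<otimes> (x \<otimes> y)) \<otimes> x) \<otimes> x))
     \<and>
     ((\<forall>x\<in>carrier Q. \<forall>y\<in>carrier Q. x \<otimes> (x \<otimes> (y \<otimes> x)) = ((x \<otimes> x) \<otimes> y) \<otimes> x) \<longleftrightarrow>
      (\<forall>x\<in>carrier Q. \<forall>y\<in>carrier Q. g2 x y = (g2 x ((x \<otimes> x) \<otimes> y) \<otimes> x) \<otimes> x))
     \<and>
     ((\<forall>x\<in>carrier Q. \<forall>y\<in>carrier Q. (x \<otimes> x) \<otimes> y = x \<otimes> (x \<otimes> y)) \<longrightarrow>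
      ((\<forall>x\<in>carrier Q. \<forall>y\<in>carrier Q. (x \<otimes> (x \<otimes> y)) \<otimes> x = x \<otimes> (x \<otimes> (y \<otimes> x))) \<longleftrightarrow>
       (\<forall>x\<in>carrier Q. \<forall>y\<in>carrier Q. ((x \<otimes> x) \<otimes> y) \<otimes> x = x \<otimes> (x \<otimes> (y \<otimes> x))))
      \<and>
      ((\<forall>x\<in>carrier Q. \<forall>y\<in>carrier Q. ((x \<otimes> x) \<otimes> y) \<otimes> x = x \<otimes> (x \<otimes> (y \<otimes> x))) \<longleftrightarrow>
       (\<forall>x\<in>carrier Q. \<forall>y\<in>carrier Q. (x \<otimes> x) \<otimes> (y \<otimes> x) = ((x \<otimes> x) \<otimes> y) \<otimes> x)))"
proof -
  interpret middle_bol_loop Q by (fact Q)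
  have g2_closed: "g2 x y \<in> carrier Q" and g2_mult: "g2 x y \<otimes> x = y \<setminus> x"
    if "x \<in> carrier Q" "y \<in> carrier Q" for x y
    using g2 that by (auto simp: rdiv_closed ldiv_closed m_closed rdiv_mult rdiv_mult_mult_eq_ldiv)
  have g2_eq_iff: "g2 x y = v \<longleftrightarrow> y \<setminus> x = v \<otimes> x"
    if "x \<in> carrier Q" "y \<in> carrier Q" "v \<in> carrier Q" for x y v
    using that r_cancel_iff[of x "g2 x y" v] by (simp add: g2_closed g2_mult)
  have once: "g2 x y = g2 x w \<otimes> x \<longleftrightarrow> w \<otimes> x = x \<otimes> (y \<otimes> x)"
    if "x \<in> carrier Q" "y \<in> carrier Q" "w \<in> carrier Q" for x y w
    using that by (simp add: g2_mult g2_eq_iff ldiv_closed mult_eq_mult_iff_ldiv)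
  have twice: "g2 x y = (g2 x w \<otimes> x) \<otimes> x \<longleftrightarrow> x \<otimes> (x \<otimes> (y \<otimes> x)) = w \<otimes> x"
    if "x \<in> carrier Q" "y \<in> carrier Q" "w \<in> carrier Q" for x y w
    using that mult_eq_mult_mult_iff_ldiv[of x y w]
    by (auto simp: g2_mult g2_eq_iff ldiv_closed m_closed)
  show ?thesis
    by (intro conjI impI) (simp_all add: once twice m_closed eq_commute)
qed

end
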